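(* Let $\Lambda'_1,\Lambda'_2,\Lambda'_3\in\mathbb{Q}$. The following identity holds: $$|\mathcal{Y}'|^{(2)}_p\equiv 1+(-1)^{\frac{p-1}{2}}\sum_{\ell=0}^{\frac{p-1}{2}}2^\ell\sum_{\substack{s+t+\ell=p-1\\0\le s,t\le\frac{p-1}{2}}}\ \sum_{\substack{i+j+k+\ell=p-1\\0\le i,j,k\le\frac{p-1}{2}}}C^{\frac{p-1}{2}}_sC^{\frac{p-1}{2}}_tC^{\frac{p-1}{2}}_\ell C^{\frac{p-1}{2}}_iC^{\frac{p-1}{2}}_jC^{\frac{p-1}{2}}_k\,(-1)^t(\Lambda'_1)^i(\Lambda'_2)^j(\Lambda'_3)^k \mod p,$$ where $C^n_k=\frac{n!}{k!\,(n-k)!}$ is the binomial coefficient $n$ choose $k$.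
   Context: $\mathcal{Y}'$ is the K3 surface birational to the twisted Legendre pencil $$y^2=-(x^2-4)(x-w)(w-\Lambda'_1)(w-\Lambda'_2)(w-\Lambda'_3).$$ Here $\Lambda'_1=(\lambda'_1+\lambda'_2\lambda'_3)/l'$, $\Lambda'_2=(\lambda'_2+\lambda'_1\lambda'_3)/l'$, $\Lambda'_3=(\lambda'_3+\lambda'_1\lambda'_2)/l'$ with $(l')^2=\lambda'_1\lambda'_2\lambda'_3$ are the moduli obtained from the Rosenhain roots of a genus-two curve $y^2=x(x-1)(x-\lambda'_1)(x-\lambda'_2)(x-\lambda'_3)$. $|\mathcal{Y}'|^{(2)}_p$ denotes the number of rational points, over the finite field $\mathbb{F}_p$, of the affine part of $\mathcal{Y}'$, defined using the displayed equation of the twisted Legendre pencil in the affine coordinates $(x,w,y)$. *)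

theory Defs
  imports Complex_Main "HOL-Number_Theory.Residues"
begin

text \<open>
  The moduli attached to the genus-two curve
  \<open>y\<^sup>2 = x (x - 1) (x - lam1) (x - lam2) (x - lam3)\<close>.  The five finite branch points must be
  pairwise distinct for the curve to have genus two; in particular \<open>l \<noteq> 0\<close>.
\<close>

definition rosenhain_moduli ::
    "complex \<Rightarrow> complex \<Rightarrow> complex \<Rightarrow> complex \<Rightarrow> complex \<Rightarrow> complex \<Rightarrow> complex \<Rightarrow> bool" where
  "rosenhain_moduli lam1 lam2 lam3 l \<Lambda>1 \<Lambda>2 \<Lambda>3 \<longleftrightarrow>
     distinct [0, 1, lam1, lam2, lam3] \<and>
     l\<^sup>2 = lam1 * lam2 * lam3 \<and>
     \<Lambda>1 = (lam1 + lam2 * lam3) / l \<and>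
     \<Lambda>2 = (lam2 + lam1 * lam3) / l \<and>
     \<Lambda>3 = (lam3 + lam1 * lam2) / l"

definition twisted_legendre_affine_points ::
    "('a, 'm) ring_scheme \<Rightarrow> 'a \<Rightarrow> 'a \<Rightarrow> 'a \<Rightarrow> ('a \<times> 'a \<times> 'a) set" where
  "twisted_legendre_affine_points R a b c =
     {(x, w, y). x \<in> carrier R \<and> w \<in> carrier R \<and> y \<in> carrier R \<and>
        y [^]\<^bsub>R\<^esub> (2::nat) =
          \<ominus>\<^bsub>R\<^esub> ((x [^]\<^bsub>R\<^esub> (2::nat) \<ominus>\<^bsub>R\<^esub> add_pow R (4::nat) \<one>\<^bsub>R\<^esub>)
             \<otimes>\<^bsub>R\<^esub> (x \<ominus>\<^bsub>R\<^esub> w)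
             \<otimes>\<^bsub>R\<^esub> (w \<ominus>\<^bsub>R\<^esub> a) \<otimes>\<^bsub>R\<^esub> (w \<ominus>\<^bsub>R\<^esub> b) \<otimes>\<^bsub>R\<^esub> (w \<ominus>\<^bsub>R\<^esub> c))}"

definition p_integral :: "nat \<Rightarrow> rat \<Rightarrow> bool" where
  "p_integral p q \<longleftrightarrow> \<not> int p dvd snd (quotient_of q)"

text \<open>
  The image of a rational number in a field \<open>R\<close>, numerator over denominator; for
  \<open>R = residue_ring p\<close> it is meaningful on the \<open>p\<close>-integral rationals, where it is the
  reduction map to the field with \<open>p\<close> elements.
\<close>

definition rat_reduce :: "('a, 'm) ring_scheme \<Rightarrow> rat \<Rightarrow> 'a" where
  "rat_reduce R q =
     add_pow R (fst (quotient_of q)) \<one>\<^bsub>R\<^esub> \<otimes>\<^bsub>R\<^esub> inv\<^bsub>R\<^esub> (add_pow R (snd (quotient_of q)) \<one>\<^bsub>R\<^esub>)"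

definition affine_point_count :: "nat \<Rightarrow> rat \<Rightarrow> rat \<Rightarrow> rat \<Rightarrow> nat" where
  "affine_point_count p \<Lambda>1 \<Lambda>2 \<Lambda>3 =
     (let F = residue_ring (int p)
      in card (twisted_legendre_affine_points F
                 (rat_reduce F \<Lambda>1) (rat_reduce F \<Lambda>2) (rat_reduce F \<Lambda>3)))"

text \<open>
  Congruence modulo \<open>p\<close> of rational numbers: the difference lies in the ideal generated by
  \<open>p\<close> in the ring of \<open>p\<close>-integral rationals.  (The library's \<open>cong\<close> would be trivial on the
  field of rationals.)
\<close>

definition rat_cong :: "nat \<Rightarrow> rat \<Rightarrow> rat \<Rightarrow> bool" where
  "rat_cong p a b \<longleftrightarrow> (\<exists>q. p_integral p q \<and> a - b = of_nat p * q)"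

end

theory Submission
  imports Defs "HOL-Number_Theory.Euler_Criterion"
begin

text \<open>
  Let \<open>p = 2 m + 1\<close> and let \<open>f(x, w)\<close> be the right-hand side of the pencil.  By Euler's criterion
  \<open>y\<^sup>2 = f(x, w)\<close> has, modulo \<open>p\<close>, \<open>1 + f(x, w)\<^sup>m\<close> solutions \<open>y\<close> (\<open>card_square_roots_cong\<close>), so modulo \<open>p\<close> the point count is \<open>p\<^sup>2\<close>, which vanishes, plus the sum of \<open>f(x, w)\<^sup>m\<close> over all \<open>x\<close> and \<open>w\<close>.
  Summing \<open>x\<^sup>e\<close> over the field gives \<open>-1\<close> if \<open>e\<close> is a positive multiple of \<open>p - 1 = 2 m\<close> and \<open>0\<close>
  otherwise (\<open>sum_power_cong\<close>), so the sum picks out certain coefficients of \<open>f\<^sup>m\<close>, and the two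
  factors \<open>-1\<close> from \<open>x\<close> and \<open>w\<close> cancel.

  The factors that contain \<open>x\<close> are \<open>(x + 2)\<^sup>m (x - 2)\<^sup>m (x - w)\<^sup>m\<close>, of degree \<open>3 m < 2 (p - 1)\<close>, so only
  \<open>x\<close> to the power \<open>p - 1\<close> counts (\<open>sum_x_cong\<close>).  In the coefficient of that power the highest power
  of \<open>w\<close> is \<open>m\<close>; together with the cubic factor, \<open>w\<close> reaches degree \<open>4 m = 2 (p - 1)\<close>.  Hence two
  powers of \<open>w\<close> count (\<open>sum_w_cong\<close>): the power \<open>p - 1\<close> gives the multiple sum of binomial coefficients,
  and the top power \<open>2 (p - 1)\<close> gives the additional summand \<open>1\<close>.

  All of this is carried out over the integers modulo \<open>p\<close>.  The rational parameters are replaced by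
  integers representing their reductions; being congruent to an integer modulo \<open>p\<close> is preserved by
  sums and products, so the right-hand side reduces termwise.
\<close>

section \<open>Power sums and square counts modulo a prime\<close>

text \<open>
  Telescoping \<open>(x + 1)\<close> to the power \<open>a + 1\<close> minus \<open>x\<close> to the same power expresses \<open>a + 1\<close> times the
  \<open>a\<close>-th power sum by lower power sums and a power of \<open>p\<close>; as \<open>a + 1 < p\<close>, this factor can be cancelled.
\<close>

lemma dvd_sum_power_small:
  assumes "prime p" "a < p - 1"
  shows "int p dvd (\<Sum>x<p. int x ^ a)"
  using assms(2)
proof (induction a rule: less_induct)
  case (less a)
  define S where "S j = (\<Sum>x<p. int x ^ j)" for j
  have tele: "(\<Sum>x<p. int (Suc x) ^ Suc a - int x ^ Suc a) = int p ^ Suc a"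
    by (subst sum_lessThan_telescope) (use less in auto)
  have step: "int (Suc x) ^ Suc a - int x ^ Suc a = (\<Sum>j\<le>a. int (Suc a choose j) * int x ^ j)" for x
  proof -
    have "int (Suc x) ^ Suc a = (int x + 1) ^ Suc a" by (simp add: add.commute)
    also have "\<dots> = (\<Sum>j\<le>Suc a. int (Suc a choose j) * int x ^ j)"
      by (subst binomial_ring) simp
    finally show ?thesis by simp
  qed
  have "int p ^ Suc a = (\<Sum>j\<le>a. int (Suc a choose j) * S j)"
    unfolding tele[symmetric] step S_def by (subst sum.swap) (simp add: sum_distrib_left)
  also have "\<dots> = (\<Sum>j<a. int (Suc a choose j) * S j) + int (Suc a) * S a"
    by (simp flip: lessThan_Suc_atMost)
  finally have eq: "int (Suc a) * S a = int p ^ Suc a - (\<Sum>j<a. int (Suc a choose j) * S j)"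
    by simp
  have "int p dvd int (Suc a) * S a"
    unfolding eq using less by (intro dvd_diff dvd_sum dvd_mult) (auto simp: S_def)
  moreover have "\<not> int p dvd int (Suc a)"
    using less.prems by (auto simp del: of_nat_Suc dest!: dvd_imp_le)
  ultimately show ?case
    using assms(1) by (auto simp: prime_dvd_mult_iff S_def)
qed

lemma fermat_int:
  assumes "prime p" "\<not> int p dvd x"
  shows "[x ^ (p - 1) = 1] (mod int p)"
proof -
  define a where "a = nat (x mod int p)"
  have a: "int a = x mod int p" using assms prime_gt_0_nat[of p] by (simp add: a_def)
  then have "\<not> int p dvd int a" using assms by (simp add: dvd_mod_iff)
  then have "[a ^ (p - 1) = 1] (mod p)" using assms fermat_theorem[of p a] by simp
  then have "[int a ^ (p - 1) = 1] (mod int p)" using cong_int_iff[of "a ^ (p - 1)" 1 p] by simp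
  then show ?thesis unfolding a by (simp add: cong_def power_mod)
qed

text \<open>
  By Fermat's little theorem, lowering a positive exponent by \<open>p - 1\<close> changes nothing as long as it
  stays positive.  The condition \<open>e > 0\<close> is essential: with \<open>0 ^ 0 = 1\<close> the exponent \<open>0\<close> gives the sum \<open>p\<close>.
\<close>

lemma sum_power_cong:
  assumes p: "prime p"
  shows "[(\<Sum>x\<in>{0..<int p}. x ^ e) = (if e > 0 \<and> (p - 1) dvd e then -1 else 0)] (mod int p)"
proof (induction e rule: less_induct)
  case (less e)
  have p1: "p > 1" using p prime_gt_1_nat by blast
  consider "e < p - 1" | "e = p - 1" | "e > p - 1" by linarith
  then show ?case
  proof cases
    case 1
    have "(\<Sum>x\<in>{0..<int p}. x ^ e) = (\<Sum>x<p. int x ^ e)"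
      by (rule sum.reindex_bij_witness[of _ int nat]) auto
    then show ?thesis
      using dvd_sum_power_small[OF p 1] 1 by (auto simp: cong_0_iff dest: dvd_imp_le)
  next
    case 2
    have "{0..<int p} = insert 0 {1..<int p}" using p1 by auto
    then have "(\<Sum>x\<in>{0..<int p}. x ^ e) = (\<Sum>x\<in>{1..<int p}. x ^ e)"
      using 2 p1 by simp
    also have "[\<dots> = (\<Sum>x\<in>{1..<int p}. 1)] (mod int p)"
      unfolding 2 by (intro cong_sum fermat_int p) (auto dest: zdvd_imp_le)
    also have "(\<Sum>x\<in>{1..<int p}. 1) = int p - 1" using p1 by simp
    also have "[int p - 1 = -1] (mod int p)" by (simp add: cong_iff_dvd_diff)
    finally show ?thesis using 2 p1 by simp
  next
    case 3
    define d where "d = e - (p - 1)"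
    have d: "e = d + (p - 1)" "d > 0" "d < e" using 3 p1 by (auto simp: d_def)
    have "[x ^ e = x ^ d] (mod int p)" for x
    proof (cases "int p dvd x")
      case True
      then have "[x = 0] (mod int p)" by (simp add: cong_0_iff)
      then have "[x ^ e = 0 ^ e] (mod int p)" "[x ^ d = 0 ^ d] (mod int p)"
        by (auto intro: cong_pow)
      then show ?thesis using d by (metis cong_sym cong_trans power_0_left less_nat_zero_code)
    next
      case False
      then show ?thesis
        unfolding d(1) power_add using cong_mult[OF cong_refl fermat_int[OF p False]] by simp
    qed
    then have "[(\<Sum>x\<in>{0..<int p}. x ^ e) = (\<Sum>x\<in>{0..<int p}. x ^ d)] (mod int p)"
      by (intro cong_sum) auto
    also note less.IH[OF d(3)]
    also have "0 < d \<and> (p - 1) dvd d \<longleftrightarrow> 0 < e \<and> (p - 1) dvd e"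
      using d(2) unfolding d(1) by simp
    finally show ?thesis .
  qed
qed

text \<open>
  The polynomial is given as a family of monomials in which exponents may repeat, so that an
  expanded product of binomial sums can be used without collecting equal powers.
\<close>

lemma sum_polynomial_cong:
  fixes c :: "'u \<Rightarrow> int"
  assumes p: "prime p" and U: "finite U"
  shows "[(\<Sum>x\<in>{0..<int p}. \<Sum>u\<in>U. c u * x ^ e u)
          = - (\<Sum>u\<in>{u\<in>U. e u > 0 \<and> (p - 1) dvd e u}. c u)] (mod int p)"
proof -
  have "(\<Sum>x\<in>{0..<int p}. \<Sum>u\<in>U. c u * x ^ e u) = (\<Sum>u\<in>U. c u * (\<Sum>x\<in>{0..<int p}. x ^ e u))"
    by (subst sum.swap) (simp add: sum_distrib_left)
  also have "[\<dots> = (\<Sum>u\<in>U. c u * (if e u > 0 \<and> (p - 1) dvd e u then -1 else 0))] (mod int p)"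
    by (intro cong_sum cong_mult cong_refl sum_power_cong p)
  also have "(\<Sum>u\<in>U. c u * (if e u > 0 \<and> (p - 1) dvd e u then -1 else 0))
      = (\<Sum>u\<in>U. if e u > 0 \<and> (p - 1) dvd e u then - c u else 0)"
    by (intro sum.cong) auto
  also have "\<dots> = - (\<Sum>u\<in>{u\<in>U. e u > 0 \<and> (p - 1) dvd e u}. c u)"
    using U unfolding sum_negf[symmetric] by (simp add: sum.inter_filter)
  finally show ?thesis .
qed

text \<open>
  The left-hand side is \<open>1 + Legendre a p\<close> exactly, and Euler's criterion evaluates the Legendre symbol.
\<close>

lemma card_square_roots_cong:
  assumes p: "prime p" "odd p"
  shows "[int (card {y\<in>{0..<int p}. [y\<^sup>2 = a] (mod int p)}) = 1 + a ^ ((p - 1) div 2)] (mod int p)"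
proof -
  let ?Y = "{y\<in>{0..<int p}. [y\<^sup>2 = a] (mod int p)}"
  have p2: "2 < p" using p prime_ge_2_nat[of p] by (cases "p = 2") auto
  have pp: "prime (int p)" using p by simp
  consider "[a = 0] (mod int p)" | "\<not> [a = 0] (mod int p)" "QuadRes (int p) a"
    | "\<not> [a = 0] (mod int p)" "\<not> QuadRes (int p) a" by blast
  then show ?thesis
  proof cases
    case 1
    have "y \<in> ?Y \<longleftrightarrow> y = 0" for y
    proof -
      have "[y\<^sup>2 = a] (mod int p) \<longleftrightarrow> int p dvd y"
        using 1 pp by (metis cong_0_iff cong_sym cong_trans prime_dvd_power_iff zero_less_numeral)
      then show ?thesis using p2 by (auto dest: zdvd_imp_le)
    qed
    then have "?Y = {0}" by blast
    moreover have "[a ^ ((p - 1) div 2) = 0 ^ ((p - 1) div 2)] (mod int p)"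
      using 1 by (rule cong_pow)
    moreover have "(0::int) ^ ((p - 1) div 2) = 0" using p2 by simp
    ultimately show ?thesis
      by (metis cong_add cong_refl cong_sym is_singletonI is_singleton_altdef of_nat_1 add.right_neutral)
  next
    case 2
    then obtain b0 where b0: "[b0\<^sup>2 = a] (mod int p)" by (auto simp: QuadRes_def)
    define b where "b = b0 mod int p"
    have b: "[b\<^sup>2 = a] (mod int p)" using b0 by (simp add: b_def cong_def power_mod)
    have br: "0 \<le> b" "b < int p" using p2 by (auto simp: b_def)
    have "b \<noteq> 0" using b 2 by (auto simp: cong_sym_eq)
    have ne: "b \<noteq> int p - b" using p(2) by presburger
    have "y \<in> ?Y \<longleftrightarrow> y = b \<or> y = int p - b" for y
    proof
      assume y: "y \<in> ?Y"
      then have "[y\<^sup>2 = b\<^sup>2] (mod int p)" using b by (auto intro: cong_trans cong_sym)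
      then have "int p dvd (y - b) * (y + b)"
        by (simp add: cong_iff_dvd_diff power2_eq_square algebra_simps)
      then consider "int p dvd y - b" | "int p dvd y + b" using pp prime_dvd_mult_iff by blast
      then show "y = b \<or> y = int p - b"
      proof cases
        case 1
        then have "[y = b] (mod int p)" by (simp add: cong_iff_dvd_diff)
        then show ?thesis using y br by (auto simp: cong_def)
      next
        case 2
        then have "[y = int p - b] (mod int p)"
          by (simp add: cong_iff_dvd_diff algebra_simps)
        then show ?thesis using y br \<open>b \<noteq> 0\<close> by (auto intro: cong_less_imp_eq_int)
      qed
    next
      have "[(int p - b)\<^sup>2 = b\<^sup>2] (mod int p)"
        by (simp add: cong_iff_dvd_diff power2_eq_square algebra_simps)
      then have "[(int p - b)\<^sup>2 = a] (mod int p)" using b cong_trans by blast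
      moreover assume "y = b \<or> y = int p - b"
      ultimately show "y \<in> ?Y" using b br \<open>b \<noteq> 0\<close> by auto
    qed
    then have "?Y = {b, int p - b}" by blast
    then have "int (card ?Y) = 1 + Legendre a p" using ne 2 by (simp add: Legendre_def)
    then show ?thesis using euler_criterion[OF p(1) p2, of a] by (metis cong_add cong_refl)
  next
    case 3
    have empty: "?Y = {}" using 3 by (auto simp: QuadRes_def)
    have "int (card ?Y) = 1 + Legendre a p" unfolding empty using 3 by (simp add: Legendre_def)
    then show ?thesis using euler_criterion[OF p(1) p2, of a] by (metis cong_add cong_refl)
  qed
qed

section \<open>Power sums of the pencil's right-hand side\<close>

text \<open>
  The indices \<open>s\<close>, \<open>t\<close>, \<open>l\<close> are the powers of \<open>x\<close> taken from the three factors.  The powers of \<open>2\<close> that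
  remain have total exponent \<open>(m - s) + (m - t) = l\<close>.
\<close>

lemma sum_x_cong:
  fixes w :: int
  assumes p: "prime p" and m: "p = 2 * m + 1"
  shows "[(\<Sum>x\<in>{0..<int p}. (x + 2) ^ m * (x - 2) ^ m * (x - w) ^ m) =
     - (\<Sum>l\<le>m. (-1) ^ l * 2 ^ l * int (m choose l) *
          (\<Sum>(s, t)\<in>{(s, t). s + t + l = 2 * m \<and> s \<le> m \<and> t \<le> m}.
             int (m choose s) * int (m choose t) * (-1) ^ t) * w ^ (m - l))] (mod int p)"
proof -
  have m0: "m > 0" using p m by (cases m) auto
  define ST where "ST l = {(s, t). s + t + l = 2 * m \<and> s \<le> m \<and> t \<le> m}" for l
  have finST: "finite (ST l)" for l
    by (rule finite_subset[of _ "{..m} \<times> {..m}"]) (auto simp: ST_def)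
  define U where "U = ({..m} \<times> {..m}) \<times> {..m}"
  define c where "c = (\<lambda>((s, t), l). (int (m choose s) * 2 ^ (m - s)) *
     (int (m choose t) * (-2) ^ (m - t)) * (int (m choose l) * (-w) ^ (m - l)))"
  define e where "e = (\<lambda>((s::nat, t), l). s + t + l)"
  have ex: "(x + b) ^ m = (\<Sum>s\<le>m. int (m choose s) * x ^ s * b ^ (m - s))" for x b :: int
    by (rule binomial_ring)
  have "(x + 2) ^ m * (x - 2) ^ m * (x - w) ^ m = (\<Sum>u\<in>U. c u * x ^ e u)" for x
    unfolding diff_conv_add_uminus ex U_def sum_product sum.cartesian_product
    by (intro sum.cong refl) (auto simp: c_def e_def power_add algebra_simps)
  then have "[(\<Sum>x\<in>{0..<int p}. (x + 2) ^ m * (x - 2) ^ m * (x - w) ^ m) =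
     - (\<Sum>u\<in>{u\<in>U. e u > 0 \<and> (p - 1) dvd e u}. c u)] (mod int p)"
    using sum_polynomial_cong[OF p, of U c e] by (simp add: U_def)
  also have "{u\<in>U. e u > 0 \<and> (p - 1) dvd e u} = {u\<in>U. e u = 2 * m}"
  proof -
    \<comment> \<open>The degree \<open>3 * m\<close> leaves no room for the exponent \<open>4 * m = 2 * (p - 1)\<close>.\<close>
    have "0 < e u \<and> (p - 1) dvd e u \<longleftrightarrow> e u = 2 * m" if "u \<in> U" for u
    proof -
      have "e u \<le> 3 * m" using that by (auto simp: U_def e_def)
      have "q = 1" if "e u = 2 * m * q" "0 < e u" for q
      proof -
        have "2 * m * q < 2 * m * 2" using \<open>e u \<le> 3 * m\<close> that m0 by linarith
        then have "q < 2" by (simp only: nat_mult_less_cancel1 mult_less_cancel1)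
        then show ?thesis using that by (cases q) auto
      qed
      then show ?thesis using m m0 by (auto elim!: dvdE)
    qed
    then show ?thesis by blast
  qed
  also have "(\<Sum>u\<in>{u\<in>U. e u = 2 * m}. c u) = (\<Sum>(l, st)\<in>Sigma {..m} ST. c (st, l))"
    by (rule sum.reindex_bij_witness[of _ "\<lambda>(l, st). (st, l)" "\<lambda>(st, l). (l, st)"])
       (auto simp: U_def e_def ST_def)
  also have "\<dots> = (\<Sum>l\<le>m. \<Sum>st\<in>ST l. c (st, l))"
    using finST by (simp add: sum.Sigma)
  also have "\<dots> = (\<Sum>l\<le>m. (-1) ^ l * 2 ^ l * int (m choose l) *
          (\<Sum>(s, t)\<in>ST l. int (m choose s) * int (m choose t) * (-1) ^ t) * w ^ (m - l))"
  proof (rule sum.cong[OF refl])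
    fix l assume "l \<in> {..m}"
    then have l: "l \<le> m" by simp
    have "c ((s, t), l) = (-1) ^ l * 2 ^ l * int (m choose l) *
        (int (m choose s) * int (m choose t) * (-1) ^ t) * w ^ (m - l)" if "(s, t) \<in> ST l" for s t
    proof -
      have st: "s + t + l = 2 * m" "s \<le> m" "t \<le> m" using that by (auto simp: ST_def)
      have 1: "(-2::int) ^ (m - t) = (-1) ^ (m - t) * 2 ^ (m - t)"
        and 2: "(-w) ^ (m - l) = (-1) ^ (m - l) * w ^ (m - l)"
        by (simp_all add: power_minus[of 2] power_minus[of w])
      have 3: "(2::int) ^ (m - s) * 2 ^ (m - t) = 2 ^ l"
      proof -
        have "(m - s) + (m - t) = l" using st by linarith
        then show ?thesis by (simp flip: power_add)
      qed
      have 4: "(-1::int) ^ (m - t) * (-1) ^ (m - l) = (-1) ^ l * (-1) ^ t"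
        using st l by (simp add: minus_one_power_iff)
      have "c ((s, t), l) = (2 ^ (m - s) * 2 ^ (m - t)) * ((-1) ^ (m - t) * (-1) ^ (m - l)) *
         int (m choose l) * (int (m choose s) * int (m choose t)) * w ^ (m - l)"
        by (simp add: c_def 1 2)
      then show ?thesis by (simp add: 3 4)
    qed
    then show "(\<Sum>st\<in>ST l. c (st, l)) = (-1) ^ l * 2 ^ l * int (m choose l) *
          (\<Sum>(s, t)\<in>ST l. int (m choose s) * int (m choose t) * (-1) ^ t) * w ^ (m - l)"
      unfolding sum_distrib_left sum_distrib_right by (intro sum.cong) auto
  qed
  finally show ?thesis unfolding ST_def .
qed

text \<open>
  The indices \<open>i\<close>, \<open>j\<close>, \<open>k\<close> are the powers of the constants, so the power of \<open>w\<close> is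
  \<open>4 m - (i + j + k + l)\<close>.  It is \<open>p - 1 = 2 m\<close> for \<open>i + j + k + l = 2 m\<close>, and \<open>2 (p - 1)\<close> only if all
  indices vanish: this is the exceptional summand for \<open>l = 0\<close>.
\<close>

lemma sum_w_cong:
  fixes a b c :: int
  assumes p: "prime p" and m: "p = 2 * m + 1" and l: "l \<le> m"
  shows "[(\<Sum>w\<in>{0..<int p}. w ^ (m - l) * ((w - a) ^ m * (w - b) ^ m * (w - c) ^ m)) =
     - ((-1) ^ l * (\<Sum>(i, j, k)\<in>{(i, j, k). i + j + k + l = 2 * m \<and> i \<le> m \<and> j \<le> m \<and> k \<le> m}.
          int (m choose i) * int (m choose j) * int (m choose k) * a ^ i * b ^ j * c ^ k)
        + (if l = 0 then 1 else 0))] (mod int p)"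
proof -
  have m0: "m > 0" using p m by (cases m) auto
  define U where "U = {..m} \<times> {..m} \<times> {..m}"
  define I where "I = {(i, j, k). i + j + k + l = 2 * m \<and> i \<le> m \<and> j \<le> m \<and> k \<le> m}"
  define h where "h = (\<lambda>(i, j, k). (int (m choose i) * (-a) ^ i) *
     (int (m choose j) * (-b) ^ j) * (int (m choose k) * (-c) ^ k))"
  define e where "e = (\<lambda>(i, j, k). (m - l) + ((m - i) + (m - j) + (m - k)))"
  have finI: "finite I"
    by (rule finite_subset[of _ U]) (auto simp: I_def U_def)
  have ex: "(w - z) ^ m = (\<Sum>s\<le>m. int (m choose s) * (-z) ^ s * w ^ (m - s))" for w z :: int
    using binomial_ring[of "-z" w m] by simp
  have "w ^ (m - l) * ((w - a) ^ m * (w - b) ^ m * (w - c) ^ m) = (\<Sum>u\<in>U. h u * w ^ e u)" for w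
  proof -
    have "(w - a) ^ m * ((w - b) ^ m * (w - c) ^ m) =
        (\<Sum>(i, j, k)\<in>U. h (i, j, k) * w ^ ((m - i) + (m - j) + (m - k)))"
      unfolding ex U_def sum_product sum.cartesian_product
      by (intro sum.cong refl) (auto simp: h_def power_add algebra_simps)
    then have "w ^ (m - l) * ((w - a) ^ m * (w - b) ^ m * (w - c) ^ m) =
        (\<Sum>(i, j, k)\<in>U. w ^ (m - l) * (h (i, j, k) * w ^ ((m - i) + (m - j) + (m - k))))"
      by (simp add: mult.assoc sum_distrib_left case_prod_unfold)
    also have "\<dots> = (\<Sum>u\<in>U. h u * w ^ e u)"
      by (intro sum.cong refl) (auto simp: e_def power_add)
    finally show ?thesis .
  qed
  then have "[(\<Sum>w\<in>{0..<int p}. w ^ (m - l) * ((w - a) ^ m * (w - b) ^ m * (w - c) ^ m)) =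
     - (\<Sum>u\<in>{u\<in>U. e u > 0 \<and> (p - 1) dvd e u}. h u)] (mod int p)"
    using sum_polynomial_cong[OF p, of U h e] by (simp add: U_def)
  also have "{u\<in>U. e u > 0 \<and> (p - 1) dvd e u} = I \<union> (if l = 0 then {(0, 0, 0)} else {})"
  proof -
    have dv: "0 < n \<and> (p - 1) dvd n \<longleftrightarrow> n = 2 * m \<or> n = 4 * m" if "n \<le> 4 * m" for n
    proof
      assume n: "0 < n \<and> (p - 1) dvd n"
      then obtain q where q: "n = 2 * m * q" using m by auto
      have "2 * m * q \<le> 2 * m * 2" using that q by simp
      then have "q \<le> 2" using m0 by (simp only: nat_mult_le_cancel1) 
      then show "n = 2 * m \<or> n = 4 * m" using n q by (auto simp: le_Suc_eq numeral_2_eq_2)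
    qed (use m m0 in auto)
    have "u \<in> U \<and> 0 < e u \<and> (p - 1) dvd e u \<longleftrightarrow> u \<in> I \<union> (if l = 0 then {(0, 0, 0)} else {})" for u
    proof (cases u)
      case (fields i j k)
      show ?thesis
      proof (cases "i \<le> m \<and> j \<le> m \<and> k \<le> m")
        case True
        then have sum: "e u + (i + j + k + l) = 4 * m" using l by (simp add: e_def fields)
        then have "0 < e u \<and> (p - 1) dvd e u \<longleftrightarrow> e u = 2 * m \<or> e u = 4 * m" by (intro dv) linarith
        also have "e u = 2 * m \<longleftrightarrow> i + j + k + l = 2 * m" using sum by linarith
        also have "e u = 4 * m \<longleftrightarrow> i = 0 \<and> j = 0 \<and> k = 0 \<and> l = 0" using sum by linarith
        finally show ?thesis using True by (simp add: fields U_def I_def)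
      next
        case False
        then have "u \<notin> U" "u \<notin> I" "u \<noteq> (0, 0, 0)" by (auto simp: fields U_def I_def)
        then show ?thesis by simp
      qed
    qed
    then show ?thesis by blast
  qed
  also have "(\<Sum>u\<in>\<dots>. h u) = (\<Sum>u\<in>I. h u) + (if l = 0 then 1 else 0)"
  proof -
    have "(0, 0, 0) \<notin> I" if "l = 0" using m0 that by (auto simp: I_def)
    moreover have "h (0, 0, 0) = 1" by (simp add: h_def)
    ultimately show ?thesis using finI by simp
  qed
  also have "(\<Sum>u\<in>I. h u) = (-1) ^ l * (\<Sum>(i, j, k)\<in>I.
      int (m choose i) * int (m choose j) * int (m choose k) * a ^ i * b ^ j * c ^ k)"
    unfolding sum_distrib_left
  proof (rule sum.cong[OF refl])
    fix u assume "u \<in> I"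
    then obtain i j k where u: "u = (i, j, k)" "i + j + k + l = 2 * m" by (auto simp: I_def)
    have "even (i + j + k + l)" using u by simp
    then have sg: "(-1::int) ^ (i + j + k) = (-1) ^ l"
      by (auto simp: minus_one_power_iff)
    have "h u = (-1) ^ (i + j + k) *
        (int (m choose i) * int (m choose j) * int (m choose k) * a ^ i * b ^ j * c ^ k)"
      by (simp add: h_def u power_minus[of a] power_minus[of b] power_minus[of c] power_add)
    then show "h u = (-1) ^ l * (case u of (i, j, k) \<Rightarrow>
       int (m choose i) * int (m choose j) * int (m choose k) * a ^ i * b ^ j * c ^ k)"
      by (simp add: sg u)
  qed
  finally show ?thesis unfolding I_def .
qed

text \<open>
  Up to the sign \<open>(-1) ^ m\<close>, this is the coefficient of \<open>(x w) ^ (2 m)\<close> in the \<open>m\<close>-th power of the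
  right-hand side of the pencil, an analogue for \<open>p = 2 m + 1\<close> of the Hasse invariant of a curve.  It is
  polymorphic so that it can be evaluated both at the rational parameters and at integers representing
  them modulo \<open>p\<close>.
\<close>

definition hasse_witt_sum :: "nat \<Rightarrow> 'a::comm_ring_1 \<Rightarrow> 'a \<Rightarrow> 'a \<Rightarrow> 'a" where
  "hasse_witt_sum m a b c =
     (\<Sum>l = 0..m. 2 ^ l *
        (\<Sum>(s, t) \<in> {(s, t). s + t + l = 2 * m \<and> s \<le> m \<and> t \<le> m}.
          (\<Sum>(i, j, k) \<in> {(i, j, k). i + j + k + l = 2 * m \<and> i \<le> m \<and> j \<le> m \<and> k \<le> m}.
            of_nat (m choose s) * of_nat (m choose t) * of_nat (m choose l) *
            of_nat (m choose i) * of_nat (m choose j) * of_nat (m choose k) *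
            (-1) ^ t * a ^ i * b ^ j * c ^ k)))"

definition twisted_legendre_rhs :: "int \<Rightarrow> int \<Rightarrow> int \<Rightarrow> int \<Rightarrow> int \<Rightarrow> int" where
  "twisted_legendre_rhs a b c x w = - ((x\<^sup>2 - 4) * (x - w) * (w - a) * (w - b) * (w - c))"

text \<open>
  For fixed \<open>w\<close> the sum over \<open>x\<close> is a combination of the powers \<open>w ^ (m - l)\<close>, to which the sum over
  \<open>w\<close> is applied term by term.
\<close>

lemma sum_twisted_legendre_power_cong:
  assumes p: "prime p" and m: "p = 2 * m + 1"
  shows "[(\<Sum>x\<in>{0..<int p}. \<Sum>w\<in>{0..<int p}. twisted_legendre_rhs a b c x w ^ m)
          = 1 + (-1) ^ m * hasse_witt_sum m a b c] (mod int p)"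
proof -
  have m0: "m > 0" using p m by (cases m) auto
  define A where "A l = (\<Sum>(s, t)\<in>{(s, t). s + t + l = 2 * m \<and> s \<le> m \<and> t \<le> m}.
             int (m choose s) * int (m choose t) * (-1) ^ t)" for l
  define B where "B l = (\<Sum>(i, j, k)\<in>{(i, j, k). i + j + k + l = 2 * m \<and> i \<le> m \<and> j \<le> m \<and> k \<le> m}.
          int (m choose i) * int (m choose j) * int (m choose k) * a ^ i * b ^ j * c ^ k)" for l
  define P where "P w = (w - a) ^ m * (w - b) ^ m * (w - c) ^ m" for w
  define d where "d l = (-1) ^ l * 2 ^ l * int (m choose l) * A l" for l
  have "(\<Sum>x\<in>{0..<int p}. \<Sum>w\<in>{0..<int p}. twisted_legendre_rhs a b c x w ^ m) =
     (\<Sum>w\<in>{0..<int p}. (-1) ^ m * P w * (\<Sum>x\<in>{0..<int p}. (x + 2) ^ m * (x - 2) ^ m * (x - w) ^ m))"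
  proof (subst sum.swap, unfold sum_distrib_left, intro sum.cong refl)
    fix x w :: int
    have eq: "twisted_legendre_rhs a b c x w =
        (-1) * ((w - a) * (w - b) * (w - c)) * ((x + 2) * (x - 2) * (x - w))"
      by (simp add: twisted_legendre_rhs_def power2_eq_square algebra_simps)
    show "twisted_legendre_rhs a b c x w ^ m =
        (-1) ^ m * P w * ((x + 2) ^ m * (x - 2) ^ m * (x - w) ^ m)"
      unfolding eq P_def power_mult_distrib by simp
  qed
  also have "[\<dots> = (\<Sum>w\<in>{0..<int p}. (-1) ^ m * P w * - (\<Sum>l\<le>m. d l * w ^ (m - l)))] (mod int p)"
    unfolding d_def A_def by (intro cong_sum cong_mult cong_refl sum_x_cong p m)
  also have "(\<Sum>w\<in>{0..<int p}. (-1) ^ m * P w * - (\<Sum>l\<le>m. d l * w ^ (m - l))) =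
      - ((-1) ^ m) * (\<Sum>l\<le>m. d l * (\<Sum>w\<in>{0..<int p}. w ^ (m - l) * P w))"
    unfolding sum_distrib_left sum_negf[symmetric]
    by (subst sum.swap, intro sum.cong refl) (simp add: algebra_simps)
  also have "[\<dots> = - ((-1) ^ m) * (\<Sum>l\<le>m. d l * - ((-1) ^ l * B l + (if l = 0 then 1 else 0)))] (mod int p)"
    unfolding P_def B_def by (intro cong_sum cong_mult cong_refl sum_w_cong p m) auto
  also have "(\<Sum>l\<le>m. d l * - ((-1) ^ l * B l + (if l = 0 then 1 else 0))) =
     - ((\<Sum>l\<le>m. 2 ^ l * int (m choose l) * A l * B l) + d 0)"
  proof -
    have "d l * - ((-1) ^ l * B l + (if l = 0 then 1 else 0)) =
       - (2 ^ l * int (m choose l) * A l * B l) - (if l = 0 then d 0 else 0)" for l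
    proof -
      have "(-1::int) ^ l * (-1) ^ l = 1" by (simp flip: power_mult_distrib)
      then have "d l * ((-1) ^ l * B l) = 2 ^ l * int (m choose l) * A l * B l"
        by (simp add: d_def algebra_simps)
      then show ?thesis by (cases "l = 0") (simp_all add: algebra_simps)
    qed
    then show ?thesis by (simp add: sum_negf sum_subtractf)
  qed
  \<comment> \<open>For \<open>l = 0\<close> only \<open>s = t = m\<close> is possible; the sign cancels against that of the right-hand side.\<close>
  also have "d 0 = (-1) ^ m"
  proof -
    have "{(s, t). s + t + 0 = 2 * m \<and> s \<le> m \<and> t \<le> m} = {(m, m)}" by auto
    then show ?thesis by (simp only: d_def A_def) simp
  qed
  also have "(\<Sum>l\<le>m. 2 ^ l * int (m choose l) * A l * B l) = hasse_witt_sum m a b c"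
  proof -
    have distrib: "z * n * sum f S * sum g T = z * (\<Sum>u\<in>S. \<Sum>v\<in>T. n * (f u * g v))"
      for z n :: int and f :: "nat \<times> nat \<Rightarrow> int" and g :: "nat \<times> nat \<times> nat \<Rightarrow> int" and S T
      by (simp add: mult.assoc sum_product[of f S g T]) (simp add: sum_distrib_left)
    show ?thesis
      unfolding hasse_witt_sum_def A_def B_def atLeast0AtMost distrib
      by (intro sum.cong refl arg_cong[where f = "(*) (2 ^ _)"]) (auto intro!: sum.cong)
  qed
  also have "- ((- 1) ^ m) * - (hasse_witt_sum m a b c + (- 1) ^ m) =
      1 + (-1) ^ m * hasse_witt_sum m a b c"
  proof -
    have "(-1::int) ^ m * (-1) ^ m = 1" by (simp flip: power_mult_distrib)
    then show ?thesis by (simp add: algebra_simps)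
  qed
  finally show ?thesis .
qed

section \<open>Counting points\<close>

lemma card_twisted_legendre_points_cong:
  assumes p: "prime p" and m: "p = 2 * m + 1"
  shows "[int (card {(x, w, y). x \<in> {0..<int p} \<and> w \<in> {0..<int p} \<and> y \<in> {0..<int p} \<and>
             [y\<^sup>2 = twisted_legendre_rhs a b c x w] (mod int p)})
          = 1 + (-1) ^ m * hasse_witt_sum m a b c] (mod int p)"
proof -
  let ?S = "{0..<int p}" and ?f = "twisted_legendre_rhs a b c"
  define Y where "Y x w = {y\<in>?S. [y\<^sup>2 = ?f x w] (mod int p)}" for x w
  have "finite (Y x w)" for x w
    by (rule finite_subset[of _ ?S]) (auto simp: Y_def)
  moreover have "{(x, w, y). x \<in> ?S \<and> w \<in> ?S \<and> y \<in> ?S \<and> [y\<^sup>2 = ?f x w] (mod int p)} =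
     Sigma ?S (\<lambda>x. Sigma ?S (Y x))" by (auto simp: Y_def)
  ultimately have "int (card {(x, w, y). x \<in> ?S \<and> w \<in> ?S \<and> y \<in> ?S \<and> [y\<^sup>2 = ?f x w] (mod int p)}) =
     (\<Sum>x\<in>?S. \<Sum>w\<in>?S. int (card (Y x w)))" by simp
  also have "[\<dots> = (\<Sum>x\<in>?S. \<Sum>w\<in>?S. 1 + ?f x w ^ ((p - 1) div 2))] (mod int p)"
    unfolding Y_def by (intro cong_sum card_square_roots_cong p) (simp add: m)
  also have "(\<Sum>x\<in>?S. \<Sum>w\<in>?S. 1 + ?f x w ^ ((p - 1) div 2)) =
     int p * int p + (\<Sum>x\<in>?S. \<Sum>w\<in>?S. ?f x w ^ m)"
    by (simp add: sum.distrib m)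
  also have "[\<dots> = 0 + (1 + (-1) ^ m * hasse_witt_sum m a b c)] (mod int p)"
    by (intro cong_add sum_twisted_legendre_power_cong p m) (simp add: cong_0_iff)
  finally show ?thesis by simp
qed

lemma (in residues) add_pow_one_eq: "add_pow R (z::int) \<one> = z mod m"
proof -
  have nat: "add_pow R (n::nat) \<one> = int n mod m" for n
    by (induction n) (auto simp: res_zero_eq res_one_eq res_add_eq mod_simps add.commute)
  show ?thesis
  proof (cases "z \<ge> 0")
    case True
    then show ?thesis by (simp add: add_pow_int_ge nat)
  next
    case False
    then show ?thesis by (simp add: add_pow_int_lt nat res_neg_eq mod_simps)
  qed
qed

lemma (in residues) twisted_legendre_affine_points_eq:
  "twisted_legendre_affine_points R a b c =
     {(x, w, y). x \<in> {0..<m} \<and> w \<in> {0..<m} \<and> y \<in> {0..<m} \<and>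
        [y\<^sup>2 = twisted_legendre_rhs a b c x w] (mod m)}"
proof -
  have four: "add_pow R (4::nat) \<one> = 4 mod m"
    using add_pow_one_eq[of 4] by (simp add: add_pow_int_ge)
  have minus: "x \<ominus> y = (x - y) mod m" for x y
    by (simp add: a_minus_def res_neg_eq res_add_eq mod_simps)
  have pow2: "x [^] (2::nat) = x\<^sup>2 mod m" if "x \<in> {0..<m}" for x
    using pow_cong[of x 2] that by (simp add: mod_pos_pos_trivial)
  have carrier: "x \<in> carrier R \<longleftrightarrow> x \<in> {0..<m}" for x by (auto simp: res_carrier_eq)
  have rhs: "\<ominus> ((x [^] (2::nat) \<ominus> add_pow R (4::nat) \<one>) \<otimes> (x \<ominus> w) \<otimes> (w \<ominus> a) \<otimes> (w \<ominus> b) \<otimes> (w \<ominus> c))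
      = twisted_legendre_rhs a b c x w mod m" if "x \<in> {0..<m}" for x w
  proof -
    have "x [^] (2::nat) \<ominus> add_pow R (4::nat) \<one> = (x\<^sup>2 - 4) mod m"
      unfolding pow2[OF that] four minus by (simp add: mod_simps)
    then show ?thesis
      by (simp add: minus res_neg_eq res_mult_eq twisted_legendre_rhs_def mod_simps)
  qed
  show ?thesis
    unfolding twisted_legendre_affine_points_def carrier
    by (rule Collect_cong, unfold case_prod_unfold, intro conj_cong refl)
      (simp only: rhs, simp only: pow2 cong_def)
qed

section \<open>Reduction of rational numbers\<close>

text \<open>
  Any denominator prime to \<open>p\<close> will do, not only the reduced one; this makes closure under sums and
  products a matter of multiplying denominators.
\<close>

lemma p_integral_iff:
  assumes p: "prime p"
  shows "p_integral p q \<longleftrightarrow> (\<exists>n d. \<not> int p dvd d \<and> q * of_int d = of_int n)"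
proof
  obtain n d where nd: "quotient_of q = (n, d)" by force
  have d: "d > 0" using quotient_of_denom_pos[OF nd] .
  have q: "q = of_int n / of_int d" using quotient_of_div[OF nd] .
  {
    assume "p_integral p q"
    then have "\<not> int p dvd d" "q * of_int d = of_int n" using nd d q by (auto simp: p_integral_def)
    then show "\<exists>n d. \<not> int p dvd d \<and> q * of_int d = of_int n" by blast
  next
    assume "\<exists>n d. \<not> int p dvd d \<and> q * of_int d = of_int n"
    then obtain n' d' where e: "\<not> int p dvd d'" "q * of_int d' = of_int n'" by blast
    have "of_int (n * d') = (of_int (n' * d) :: rat)"
      using e(2) d by (simp add: q field_simps)
    then have "n * d' = n' * d" by linarith
    then have "d dvd n * d'" by simp
    then have "d dvd d'"
      using quotient_of_coprime[OF nd] by (metis coprime_commute coprime_dvd_mult_right_iff)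
    then show "p_integral p q" using e(1) nd by (auto simp: p_integral_def dest: dvd_trans)
  }
qed

lemma p_integral_of_int: "prime p \<Longrightarrow> p_integral p (of_int n)"
  using prime_gt_1_nat[of p] by (auto simp: p_integral_def)

lemma p_integral_add_mult:
  assumes p: "prime p" and "p_integral p q" "p_integral p r"
  shows "p_integral p (q + r)" "p_integral p (q * r)"
proof -
  obtain n d n' d' where e: "\<not> int p dvd d" "q * of_int d = of_int n"
    "\<not> int p dvd d'" "r * of_int d' = of_int n'"
    using assms by (auto simp: p_integral_iff)
  have nd: "\<not> int p dvd d * d'" using e p by (simp add: prime_dvd_mult_iff)
  have "(q + r) * of_int (d * d') = (q * of_int d) * of_int d' + (r * of_int d') * of_int d"
    by (simp add: algebra_simps)
  also have "\<dots> = of_int (n * d' + n' * d)" by (simp add: e)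
  finally show "p_integral p (q + r)" using nd p_integral_iff[OF p] by blast
  have "(q * r) * of_int (d * d') = (q * of_int d) * (r * of_int d')"
    by (simp add: algebra_simps)
  also have "\<dots> = of_int (n * n')" by (simp add: e)
  finally show "p_integral p (q * r)" using nd p_integral_iff[OF p] by blast
qed

text \<open>
  Only congruences with an integer on the right are considered: such a rational is automatically
  \<open>p\<close>-integral, so products need no separate integrality assumptions.
\<close>

lemma rat_cong_of_int_iff:
  assumes p: "prime p"
  shows "rat_cong p q (of_int a) \<longleftrightarrow> (\<exists>r. p_integral p r \<and> q = of_int a + of_nat p * r)"
  by (auto simp: rat_cong_def algebra_simps)

lemma rat_cong_of_int_self: "prime p \<Longrightarrow> rat_cong p (of_int a) (of_int a)"
  using p_integral_of_int[of p 0] by (auto simp: rat_cong_def)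

lemma rat_cong_of_int_add:
  assumes p: "prime p" and "rat_cong p q (of_int a)" "rat_cong p r (of_int b)"
  shows "rat_cong p (q + r) (of_int (a + b))"
proof -
  obtain u v where uv: "p_integral p u" "q = of_int a + of_nat p * u"
    "p_integral p v" "r = of_int b + of_nat p * v"
    using assms by (auto simp: rat_cong_of_int_iff)
  have "p_integral p (u + v)" using uv p_integral_add_mult p by blast
  moreover have "q + r = of_int (a + b) + of_nat p * (u + v)" by (simp add: uv algebra_simps)
  ultimately show ?thesis using rat_cong_of_int_iff[OF p] by blast
qed

lemma rat_cong_of_int_mult:
  assumes p: "prime p" and "rat_cong p q (of_int a)" "rat_cong p r (of_int b)"
  shows "rat_cong p (q * r) (of_int (a * b))"
proof -
  obtain u v where uv: "p_integral p u" "q = of_int a + of_nat p * u"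
    "p_integral p v" "r = of_int b + of_nat p * v"
    using assms by (auto simp: rat_cong_of_int_iff)
  let ?t = "(of_int a * v + of_int b * u) + of_int (int p) * (u * v)"
  have "p_integral p ?t" using uv p by (intro p_integral_add_mult p_integral_of_int)
  moreover have "q * r = of_int (a * b) + of_nat p * ?t" by (simp add: uv algebra_simps)
  ultimately show ?thesis using rat_cong_of_int_iff[OF p] by blast
qed

lemma rat_cong_of_int_power:
  assumes p: "prime p" and "rat_cong p q (of_int a)"
  shows "rat_cong p (q ^ n) (of_int (a ^ n))"
proof (induction n)
  case 0
  show ?case using rat_cong_of_int_self[OF p, of 1] by simp
next
  case (Suc n)
  show ?case using rat_cong_of_int_mult[OF p assms(2) Suc.IH] by simp
qed

lemma rat_cong_of_int_sum:
  assumes p: "prime p" and "\<And>u. u \<in> U \<Longrightarrow> rat_cong p (f u) (of_int (g u))"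
  shows "rat_cong p (\<Sum>u\<in>U. f u) (of_int (\<Sum>u\<in>U. g u))"
  using assms(2)
proof (induction U rule: infinite_finite_induct)
  case (insert u U)
  have "rat_cong p (f u + sum f U) (of_int (g u + sum g U))"
    using insert by (intro rat_cong_of_int_add p) auto
  then show ?case using insert by simp
qed (use rat_cong_of_int_self[OF p, of 0] in auto)

lemma rat_cong_of_nat: "prime p \<Longrightarrow> rat_cong p (of_nat n) (of_int (of_nat n))"
  using rat_cong_of_int_self[of p "int n"] by simp

lemma rat_cong_hasse_witt_sum:
  assumes p: "prime p" and
    "rat_cong p q1 (of_int a)" "rat_cong p q2 (of_int b)" "rat_cong p q3 (of_int c)"
  shows "rat_cong p (hasse_witt_sum m q1 q2 q3) (of_int (hasse_witt_sum m a b c))"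
proof -
  have const: "rat_cong p 2 (of_int 2)" "rat_cong p (-1) (of_int (-1))"
    using rat_cong_of_int_self[OF p, of 2] rat_cong_of_int_self[OF p, of "-1"] by auto
  show ?thesis
    unfolding hasse_witt_sum_def case_prod_unfold
    by (intro rat_cong_of_int_sum rat_cong_of_int_mult rat_cong_of_int_power
        rat_cong_of_nat const assms)
qed

text \<open>
  Elements of \<open>residue_ring (int p)\<close> are integers, so the reduction of \<open>q\<close> is itself an integer
  representative of \<open>q\<close> modulo \<open>p\<close>.
\<close>

lemma rat_cong_rat_reduce:
  assumes p: "prime p" and q: "p_integral p q"
  shows "rat_cong p q (of_int (rat_reduce (residue_ring (int p)) q))"
proof -
  define R where "R = residue_ring (int p)"
  interpret residues_prime p R
    using p by unfold_locales (auto simp: R_def)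
  obtain n d where nd: "quotient_of q = (n, d)" by force
  have d: "d > 0" using quotient_of_denom_pos[OF nd] .
  have qe: "q = of_int n / of_int d" using quotient_of_div[OF nd] .
  have ndvd: "\<not> int p dvd d" using q nd by (simp add: p_integral_def)
  define z where "z = rat_reduce R q"
  have unit: "d mod int p \<in> Units R"
    using ndvd m_gt_one p_coprime_right_int by (intro mod_in_res_units) auto
  have zdef: "z = (n mod int p) \<otimes>\<^bsub>R\<^esub> inv\<^bsub>R\<^esub> (d mod int p)"
    by (simp add: z_def rat_reduce_def nd add_pow_one_eq)
  have "z \<otimes>\<^bsub>R\<^esub> (d mod int p) = n mod int p"
    unfolding zdef using unit by (simp add: m_assoc)
  then have "[z * d = n] (mod int p)"
    by (simp add: res_mult_eq cong_def mod_simps)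
  then obtain k where k: "n = z * d + int p * k"
    by (metis cong_iff_lin cong_sym mult.commute)
  have "p_integral p (of_int k / of_int d)"
    unfolding p_integral_iff[OF p] using ndvd d by (intro exI[of _ k] exI[of _ d]) auto
  moreover have "q = of_int z + of_nat p * (of_int k / of_int d)"
    using d by (simp add: qe k field_simps)
  ultimately show ?thesis
    unfolding R_def[symmetric] z_def[symmetric] rat_cong_of_int_iff[OF p] by blast
qed

section \<open>The point count of the twisted Legendre pencil\<close>

theorem theorem3p18:
  fixes p :: nat
    and lam1 lam2 lam3 l' :: complex
    and \<Lambda>1 \<Lambda>2 \<Lambda>3 :: rat
  assumes "prime p" and "odd p"
    and "rosenhain_moduli lam1 lam2 lam3 l' (of_rat \<Lambda>1) (of_rat \<Lambda>2) (of_rat \<Lambda>3)"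
    and "p_integral p \<Lambda>1" and "p_integral p \<Lambda>2" and "p_integral p \<Lambda>3"
  shows "rat_cong p (of_nat (affine_point_count p \<Lambda>1 \<Lambda>2 \<Lambda>3))
    (1 + (-1) ^ ((p - 1) div 2) *
      (\<Sum>l = 0..(p - 1) div 2. 2 ^ l *
        (\<Sum>(s, t) \<in> {(s, t). s + t + l = p - 1 \<and> s \<le> (p - 1) div 2 \<and> t \<le> (p - 1) div 2}.
          (\<Sum>(i, j, k) \<in> {(i, j, k). i + j + k + l = p - 1 \<and>
                i \<le> (p - 1) div 2 \<and> j \<le> (p - 1) div 2 \<and> k \<le> (p - 1) div 2}.
            of_nat ((p - 1) div 2 choose s) * of_nat ((p - 1) div 2 choose t) *
            of_nat ((p - 1) div 2 choose l) * of_nat ((p - 1) div 2 choose i) *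
            of_nat ((p - 1) div 2 choose j) * of_nat ((p - 1) div 2 choose k) *
            (-1) ^ t * \<Lambda>1 ^ i * \<Lambda>2 ^ j * \<Lambda>3 ^ k))))"
proof -
  note p = \<open>prime p\<close>
  define m where "m = (p - 1) div 2"
  have m: "p = 2 * m + 1" "p - 1 = 2 * m" using \<open>odd p\<close> by (auto simp: m_def elim!: oddE)
  define R where "R = residue_ring (int p)"
  interpret residues_prime p R
    using p by unfold_locales (auto simp: R_def)
  define a b c where abc: "a = rat_reduce R \<Lambda>1" "b = rat_reduce R \<Lambda>2" "c = rat_reduce R \<Lambda>3"
  define N where "N = affine_point_count p \<Lambda>1 \<Lambda>2 \<Lambda>3"
  define E where "E = 1 + (-1) ^ m * hasse_witt_sum m a b c"
  define Q where "Q = 1 + (-1) ^ m * hasse_witt_sum m \<Lambda>1 \<Lambda>2 \<Lambda>3"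
  have "N = card (twisted_legendre_affine_points R a b c)"
    by (simp add: N_def affine_point_count_def R_def abc Let_def)
  then have "[int N = E] (mod int p)"
    using card_twisted_legendre_points_cong[OF p m(1), of a b c]
    by (simp add: twisted_legendre_affine_points_eq E_def)
  then obtain k where k: "int N = E + int p * k"
    by (metis cong_iff_lin cong_sym mult.commute)
  have red: "rat_cong p \<Lambda>1 (of_int a)" "rat_cong p \<Lambda>2 (of_int b)" "rat_cong p \<Lambda>3 (of_int c)"
    using rat_cong_rat_reduce[OF p] assms by (auto simp: abc R_def)
  have "rat_cong p (1 + (-1) ^ m * hasse_witt_sum m \<Lambda>1 \<Lambda>2 \<Lambda>3) (of_int E)"
    unfolding E_def
    using rat_cong_of_int_self[OF p, of 1] rat_cong_of_int_self[OF p, of "-1"]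
    by (intro rat_cong_of_int_add rat_cong_of_int_mult rat_cong_of_int_power
        rat_cong_hasse_witt_sum red p) simp_all
  then obtain r where r: "p_integral p r" "Q = of_int E + of_nat p * r"
    unfolding Q_def rat_cong_of_int_iff[OF p] by blast
  have "p_integral p (of_int k + of_int (-1) * r)"
    using r p by (intro p_integral_add_mult p_integral_of_int)
  moreover have "of_nat N - Q = of_nat p * (of_int k + of_int (-1) * r)"
  proof -
    have "(of_nat N :: rat) = of_int (int N)" by simp
    also have "\<dots> = of_int E + of_nat p * of_int k" unfolding k by simp
    finally show ?thesis by (simp add: r algebra_simps)
  qed
  ultimately have "rat_cong p (of_nat N) Q" unfolding rat_cong_def by blast
  moreover have "2 * m div 2 = m" by simp
  ultimately show ?thesis
    unfolding N_def Q_def hasse_witt_sum_def m(2) by (simp only:)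
qed

end
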